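(* Let $v$ be a weight. Let $\varphi:[0,\infty[\to]0,\infty[$ be a continuous non-decreasing function for which there is $r_\varphi>0$ such that: $\varphi$ is of class $C^2$ on $[r_\varphi,\infty[$; $\varphi'$ is non-decreasing on $[r_\varphi,\infty[$; $\varphi'(r_\varphi)>0$; $r^n=O(\varphi'(r))$ as $r\to\infty$ for each $n\in\mathbb{N}$; and $\sup_{r\ge r_\varphi}\frac{\varphi''(r)\varphi(r)}{(\varphi'(r))^2}<\infty$. Let $w_\varphi(z):=1/\varphi(|z|)$, $z\in\mathbb{C}$ (this is a weight). The following conditions are equivalent for an entire function $g\in H(\mathbb{C})$: (1) $V_g:H^\infty_v(\mathbb{C})\to H^\infty_{w_\varphi}(\mathbb{C})$ is continuous. (2) $V_g:H^0_v(\mathbb{C})\to H^0_{w_\varphi}(\mathbb{C})$ is continuous. (3) $\sup_{|z|\ge r_\varphi}\frac{|g'(z)|}{\varphi'(|z|)\,\tilde v(z)}<\infty$.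
   Context: $H(\mathbb{C})$ is the space of entire functions. A weight is a continuous non-increasing function $v:[0,\infty[\to]0,\infty[$ with $\lim_{r\to\infty}r^mv(r)=0$ for each $m\in\mathbb{N}$; it is extended to $\mathbb{C}$ by $v(z):=v(|z|)$. For a weight $v$, $H^\infty_v(\mathbb{C})=\{f\in H(\mathbb{C}):\|f\|_v:=\sup_{z\in\mathbb{C}}v(|z|)|f(z)|<\infty\}$ and $H^0_v(\mathbb{C})=\{f\in H(\mathbb{C}):\lim_{|z|\to\infty}v(|z|)|f(z)|=0\}$, both endowed with the norm $\|\cdot\|_v$ (they are Banach spaces). The associated weight is $\tilde v(z):=\big(\sup\{|f(z)|:f\in H^\infty_v(\mathbb{C}),\ \|f\|_v\le1\}\big)^{-1}$, $z\in\mathbb{C}$. For $g\in H(\mathbb{C})$ the Volterra operator is $V_g(f)(z):=\int_0^zf(\zeta)g'(\zeta)\,d\zeta$, $f\in H(\mathbb{C})$, $z\in\mathbb{C}$. Saying that an operator $T:X\to Y$ between two such spaces is continuous means that $T$ maps $X$ into $Y$ and is continuous for the given norms. *)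

theory Defs
  imports "HOL-Complex_Analysis.Complex_Analysis" "HOL-Library.Landau_Symbols"
begin

text \<open>Weights live on \<open>[0,\<infinity>[\<close> and are encoded as total functions on the reals whose values at
  negative arguments are irrelevant; the extension to the plane is \<open>\<lambda>z. v (cmod z)\<close>.\<close>

definition is_weight :: "(real \<Rightarrow> real) \<Rightarrow> bool" where
  "is_weight v \<longleftrightarrow>
     continuous_on {0..} v \<and> antimono_on {0..} v \<and> (\<forall>r\<ge>0. v r > 0) \<and>
     (\<forall>m::nat. ((\<lambda>r. r ^ m * v r) \<longlongrightarrow> 0) at_top)"

definition wnorm :: "(real \<Rightarrow> real) \<Rightarrow> (complex \<Rightarrow> complex) \<Rightarrow> real" where
  "wnorm v f = (SUP z. v (cmod z) * cmod (f z))"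

definition H_inf :: "(real \<Rightarrow> real) \<Rightarrow> (complex \<Rightarrow> complex) set" where
  "H_inf v = {f. f holomorphic_on UNIV \<and> bdd_above (range (\<lambda>z. v (cmod z) * cmod (f z)))}"

definition H_zero :: "(real \<Rightarrow> real) \<Rightarrow> (complex \<Rightarrow> complex) set" where
  "H_zero v = {f. f holomorphic_on UNIV \<and> ((\<lambda>z. v (cmod z) * cmod (f z)) \<longlongrightarrow> 0) at_infinity}"

text \<open>Outside \<open>H_inf v\<close> the supremum in \<open>wnorm\<close> is unspecified, whereas a \<open>Metric_space\<close>
  distance must be nonnegative and symmetric for all arguments, hence the guard. It does not
  influence the topology.\<close>

definition wdist ::
    "(real \<Rightarrow> real) \<Rightarrow> (complex \<Rightarrow> complex) set \<Rightarrow> (complex \<Rightarrow> complex) \<Rightarrow> (complex \<Rightarrow> complex) \<Rightarrow> real" where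
  "wdist v X f g = (if f \<in> X \<and> g \<in> X then wnorm v (\<lambda>z. f z - g z) else 0)"

definition wnorm_topology ::
    "(real \<Rightarrow> real) \<Rightarrow> (complex \<Rightarrow> complex) set \<Rightarrow> (complex \<Rightarrow> complex) topology" where
  "wnorm_topology v X = Metric_space.mtopology X (wdist v X)"

definition assoc_weight :: "(real \<Rightarrow> real) \<Rightarrow> complex \<Rightarrow> real" where
  "assoc_weight v z = inverse (SUP f\<in>{f \<in> H_inf v. wnorm v f \<le> 1}. cmod (f z))"

definition Volterra :: "(complex \<Rightarrow> complex) \<Rightarrow> (complex \<Rightarrow> complex) \<Rightarrow> complex \<Rightarrow> complex" where
  "Volterra g f z = contour_integral (linepath 0 z) (\<lambda>\<zeta>. f \<zeta> * deriv g \<zeta>)"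

text \<open>The facts below show that for a weight the weighted norm makes both spaces metric spaces, so
  that \<open>wnorm_topology\<close> is the norm topology on the whole carrier. In particular
  \<open>continuous_map\<close> between these topologies includes that the operator maps the first space
  into the second.\<close>

lemma H_zero_subset_H_inf:
  assumes "is_weight v"
  shows "H_zero v \<subseteq> H_inf v"
proof
  fix f assume f: "f \<in> H_zero v"
  let ?h = "\<lambda>z. v (cmod z) * cmod (f z)"
  have hol: "f holomorphic_on UNIV" and lim: "(?h \<longlongrightarrow> 0) at_infinity"
    using f by (auto simp: H_zero_def)
  have "eventually (\<lambda>z. ?h z < 1) at_infinity"
    using order_tendstoD(2)[OF lim, of 1] by simp
  then obtain R where R: "\<And>z. cmod z \<ge> R \<Longrightarrow> ?h z < 1"
    by (auto simp: eventually_at_infinity)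
  have "continuous_on UNIV (\<lambda>z::complex. v (cmod z))"
    by (rule continuous_on_compose2[of "{0..}" v])
       (use assms in \<open>auto simp: is_weight_def intro: continuous_intros\<close>)
  then have "continuous_on (cball 0 R) ?h"
    by (intro continuous_intros) (auto intro: continuous_on_subset holomorphic_on_imp_continuous_on[OF hol])
  then have "compact (?h ` cball 0 R)"
    by (rule compact_continuous_image) simp
  then have "bdd_above (?h ` cball 0 R)"
    by (intro bounded_imp_bdd_above compact_imp_bounded)
  then obtain B where "\<forall>z\<in>cball 0 R. ?h z \<le> B"
    by (auto simp: bdd_above_def)
  then have B: "?h z \<le> B" if "cmod z \<le> R" for z
    using that by simp
  have "?h z \<le> max B 1" for z
    using R[of z] B[of z] by (cases "cmod z \<le> R") auto
  then have "bdd_above (range ?h)" by (auto intro!: bdd_aboveI2)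
  with hol show "f \<in> H_inf v" by (simp add: H_inf_def)
qed

lemma Metric_space_wdist:
  assumes v: "is_weight v" and X: "X \<subseteq> H_inf v"
  shows "Metric_space X (wdist v X)"
proof -
  have pos: "v (cmod z) > 0" for z using v by (auto simp: is_weight_def)
  have bdd: "bdd_above (range (\<lambda>z. v (cmod z) * cmod (f z - g z)))"
    if "f \<in> X" "g \<in> X" for f g
  proof -
    from that X obtain A B where "\<And>z. v (cmod z) * cmod (f z) \<le> A" "\<And>z. v (cmod z) * cmod (g z) \<le> B"
      by (fastforce simp: H_inf_def bdd_above_def)
    moreover have "v (cmod z) * cmod (f z - g z) \<le> v (cmod z) * cmod (f z) + v (cmod z) * cmod (g z)" for z
      using mult_left_mono[OF norm_triangle_ineq4[of "f z" "g z"], of "v (cmod z)"] pos[of z]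
      by (simp add: algebra_simps)
    ultimately show ?thesis
      by (intro bdd_aboveI2[of _ _ "A + B"]) (meson add_mono order_trans)
  qed
  have le: "v (cmod z) * cmod (f z - g z) \<le> wnorm v (\<lambda>z. f z - g z)" if "f \<in> X" "g \<in> X" for f g z
    unfolding wnorm_def by (rule cSUP_upper[OF _ bdd[OF that]]) simp
  show ?thesis
  proof
    fix f g
    show "wdist v X f g = wdist v X g f"
      by (simp add: wdist_def wnorm_def norm_minus_commute)
    have "0 \<le> v (cmod 0) * cmod (f 0 - g 0)" using pos[of 0] by simp
    then show "0 \<le> wdist v X f g"
      using le[of f g 0] by (auto simp: wdist_def)
  next
    fix f g assume fg: "f \<in> X" "g \<in> X"
    show "wdist v X f g = 0 \<longleftrightarrow> f = g"
    proof
      assume "wdist v X f g = 0"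
      then have "v (cmod z) * cmod (f z - g z) \<le> 0" for z
        using le[OF fg, of z] fg by (simp add: wdist_def)
      then have "f z = g z" for z
        using pos[of z] by (metis eq_iff_diff_eq_0 mult_pos_pos not_le zero_less_norm_iff)
      then show "f = g" by blast
    qed (simp add: wdist_def wnorm_def)
  next
    fix f g h assume X': "f \<in> X" "g \<in> X" "h \<in> X"
    have "v (cmod z) * cmod (f z - h z) \<le> wnorm v (\<lambda>z. f z - g z) + wnorm v (\<lambda>z. g z - h z)" for z
    proof -
      have "cmod (f z - h z) \<le> cmod (f z - g z) + cmod (g z - h z)"
        using norm_triangle_ineq[of "f z - g z" "g z - h z"] by simp
      then have "v (cmod z) * cmod (f z - h z) \<le> v (cmod z) * cmod (f z - g z) + v (cmod z) * cmod (g z - h z)"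
        using pos[of z] by (simp add: distrib_left[symmetric])
      also have "\<dots> \<le> wnorm v (\<lambda>z. f z - g z) + wnorm v (\<lambda>z. g z - h z)"
        by (intro add_mono le X')
      finally show ?thesis .
    qed
    then have "wnorm v (\<lambda>z. f z - h z) \<le> wnorm v (\<lambda>z. f z - g z) + wnorm v (\<lambda>z. g z - h z)"
      unfolding wnorm_def[of v "\<lambda>z. f z - h z"] by (intro cSUP_least) auto
    then show "wdist v X f h \<le> wdist v X f g + wdist v X g h"
      using X' by (simp add: wdist_def)
  qed
qed

lemma topspace_wnorm_topology:
  assumes "is_weight v"
  shows "topspace (wnorm_topology v (H_inf v)) = H_inf v"
    and "topspace (wnorm_topology v (H_zero v)) = H_zero v"
  using Metric_space_wdist[OF assms, of "H_inf v"]
    Metric_space_wdist[OF assms H_zero_subset_H_inf[OF assms]]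
  by (auto simp: wnorm_topology_def Metric_space.topspace_mtopology)

end

theory Submission
  imports Defs "HOL-Real_Asymp.Real_Asymp"
begin

text \<open>The derivative of \<open>Volterra g f\<close> is \<open>f * deriv g\<close>, and the inverse of the associated weight at
  \<open>z\<close> is the largest possible value of \<open>cmod (f z)\<close> for \<open>f\<close> in the unit ball of \<open>H_inf v\<close>. So the
  condition on \<open>g\<close> says that the derivatives of the images of the unit ball are bounded by
  a common multiple of \<open>\<phi>'\<close> outside a disc. For entire functions this is the same as a bound by
  \<open>\<phi>\<close> for the functions themselves, that is, as boundedness of the operator.

  One direction of this last equivalence is integration along rays
  (\<open>growth_of_deriv_bound\<close>). The other one is Cauchy's inequality on a disc of radius comparable with
  \<open>\<phi> / \<phi>'\<close> (\<open>deriv_bound_of_growth\<close>). It works since \<open>\<phi>\<close> grows by at most a constant factor across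
  such a disc, and this is what the bound on \<open>\<phi>'' \<phi> / \<phi>'\<^sup>2\<close> gives (\<open>bounded_ratio_on_step\<close>).

  The smaller space \<open>H_zero v\<close> leads to the same condition on \<open>g\<close> because of the dilations
  \<open>f (r z)\<close> with \<open>r < 1\<close>. They do not increase the weighted norm, they map \<open>H_inf v\<close> into \<open>H_zero v\<close>, and
  they are approximated by polynomials. Hence the unit ball of \<open>H_zero v\<close> determines the associated weight
  (\<open>inverse_assoc_weight_le\<close>), so continuity on \<open>H_zero v\<close> already forces the condition. Conversely a function
  in \<open>H_zero v\<close> times the associated weight tends to \<open>0\<close> (\<open>assoc_weight_H_zero_tendsto_0\<close>), so under
  the condition its image is little-o of \<open>\<phi>\<close> (\<open>Volterra_H_zero\<close>).\<close>

section \<open>Weighted norms and bounded operators\<close>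

lemma weight_pos: "is_weight v \<Longrightarrow> 0 < v (cmod z)"
  by (simp add: is_weight_def)

lemma wnorm_upper: "f \<in> H_inf v \<Longrightarrow> v (cmod z) * cmod (f z) \<le> wnorm v f"
  unfolding wnorm_def H_inf_def by (auto intro: cSUP_upper)

lemma wnorm_least: "(\<And>z. v (cmod z) * cmod (f z) \<le> N) \<Longrightarrow> wnorm v f \<le> N"
  unfolding wnorm_def by (rule cSUP_least) auto

lemma wnorm_nonneg:
  assumes "is_weight v" "f \<in> H_inf v"
  shows "0 \<le> wnorm v f"
proof -
  have "0 \<le> v (cmod 0) * cmod (f 0)"
    using weight_pos[OF assms(1), of 0] by simp
  then show ?thesis
    using wnorm_upper[OF assms(2), of 0] by linarith
qed

lemma wnorm_scale:
  assumes "is_weight v" "f \<in> H_inf v"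
  shows "wnorm v (\<lambda>z. c * f z) \<le> cmod c * wnorm v f"
proof (rule wnorm_least)
  fix z
  have "cmod c * (v (cmod z) * cmod (f z)) \<le> cmod c * wnorm v f"
    using wnorm_upper[OF assms(2), of z] by (rule mult_left_mono) simp
  then show "v (cmod z) * cmod (c * f z) \<le> cmod c * wnorm v f"
    by (simp add: norm_mult mult_ac)
qed

lemma H_infI:
  assumes "f holomorphic_on UNIV" "\<And>z. v (cmod z) * cmod (f z) \<le> N"
  shows "f \<in> H_inf v"
  using assms by (auto simp: H_inf_def intro!: bdd_aboveI2)

lemma H_inf_diff:
  assumes v: "is_weight v" and f: "f \<in> H_inf v" and g: "g \<in> H_inf v"
  shows "(\<lambda>z. f z - g z) \<in> H_inf v"
proof (rule H_infI)
  show "(\<lambda>z. f z - g z) holomorphic_on UNIV"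
    using f g by (auto simp: H_inf_def intro!: holomorphic_intros)
  fix z
  have "v (cmod z) * cmod (f z - g z) \<le> v (cmod z) * (cmod (f z) + cmod (g z))"
    using weight_pos[OF v, of z] by (intro mult_left_mono norm_triangle_ineq4) auto
  then show "v (cmod z) * cmod (f z - g z) \<le> wnorm v f + wnorm v g"
    using wnorm_upper[OF f, of z] wnorm_upper[OF g, of z] by (simp add: distrib_left)
qed

lemma H_inf_scale:
  assumes v: "is_weight v" and f: "f \<in> H_inf v"
  shows "(\<lambda>z. c * f z) \<in> H_inf v"
proof (rule H_infI)
  show "(\<lambda>z. c * f z) holomorphic_on UNIV"
    using f by (auto simp: H_inf_def intro!: holomorphic_intros)
  fix z
  have "cmod c * (v (cmod z) * cmod (f z)) \<le> cmod c * wnorm v f"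
    using wnorm_upper[OF f, of z] by (rule mult_left_mono) simp
  then show "v (cmod z) * cmod (c * f z) \<le> cmod c * wnorm v f"
    by (simp add: norm_mult mult_ac)
qed

lemma H_zero_scale:
  assumes "f \<in> H_zero v"
  shows "(\<lambda>z. c * f z) \<in> H_zero v"
proof -
  have "((\<lambda>z. cmod c * (v (cmod z) * cmod (f z))) \<longlongrightarrow> cmod c * 0) at_infinity"
    using assms by (intro tendsto_mult_left) (simp add: H_zero_def)
  then show ?thesis
    using assms by (auto simp: H_zero_def norm_mult mult_ac intro!: holomorphic_intros)
qed

lemma H_zero_add:
  assumes v: "is_weight v" and f: "f \<in> H_zero v" and g: "g \<in> H_zero v"
  shows "(\<lambda>z. f z + g z) \<in> H_zero v"
proof -
  have "((\<lambda>z. v (cmod z) * cmod (f z) + v (cmod z) * cmod (g z)) \<longlongrightarrow> 0 + 0) at_infinity"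
    using f g by (intro tendsto_add) (auto simp: H_zero_def)
  then have lim: "((\<lambda>z. v (cmod z) * cmod (f z) + v (cmod z) * cmod (g z)) \<longlongrightarrow> 0) at_infinity"
    by simp
  have "((\<lambda>z. v (cmod z) * cmod (f z + g z)) \<longlongrightarrow> 0) at_infinity"
  proof (rule tendsto_0_le[OF lim, of _ 1], rule always_eventually, rule allI)
    fix z
    have "v (cmod z) * cmod (f z + g z) \<le> v (cmod z) * (cmod (f z) + cmod (g z))"
      using weight_pos[OF v, of z] by (intro mult_left_mono norm_triangle_ineq) auto
    then show "norm (v (cmod z) * cmod (f z + g z))
        \<le> norm (v (cmod z) * cmod (f z) + v (cmod z) * cmod (g z)) * 1"
      using weight_pos[OF v, of z] by (simp add: abs_mult distrib_left)
  qed
  then show ?thesis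
    using f g by (auto simp: H_zero_def intro!: holomorphic_intros)
qed

lemma H_zero_diff:
  assumes "is_weight v" "f \<in> H_zero v" "g \<in> H_zero v"
  shows "(\<lambda>z. f z - g z) \<in> H_zero v"
  using H_zero_add[OF assms(1,2) H_zero_scale[OF assms(3), of "-1"]] by simp

text \<open>The usual argument for normed spaces: continuity at \<open>0\<close> gives a radius \<open>\<delta>\<close> such that the ball of
radius \<open>\<delta>\<close> goes into the unit ball, and scaling turns this into an estimate for all functions.\<close>

lemma continuous_map_wnorm_iff_bounded:
  assumes v: "is_weight v" and w: "is_weight w"
    and X: "X \<subseteq> H_inf v" and Y: "Y \<subseteq> H_inf w"
    and X_diff: "\<And>f h. f \<in> X \<Longrightarrow> h \<in> X \<Longrightarrow> (\<lambda>z. f z - h z) \<in> X"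
    and X_scale: "\<And>c f. f \<in> X \<Longrightarrow> (\<lambda>z. c * f z) \<in> X"
    and T_diff: "\<And>f h. f \<in> X \<Longrightarrow> h \<in> X \<Longrightarrow> T (\<lambda>z. f z - h z) = (\<lambda>z. T f z - T h z)"
    and T_scale: "\<And>c f. f \<in> X \<Longrightarrow> T (\<lambda>z. c * f z) = (\<lambda>z. c * T f z)"
  shows "continuous_map (wnorm_topology v X) (wnorm_topology w Y) T \<longleftrightarrow>
     T ` X \<subseteq> Y \<and> (\<exists>C. \<forall>f\<in>X. wnorm w (T f) \<le> C * wnorm v f)"
proof -
  interpret MX: Metric_space X "wdist v X" by (rule Metric_space_wdist[OF v X])
  have MY: "Metric_space Y (wdist w Y)" by (rule Metric_space_wdist[OF w Y])
  have iff: "continuous_map (wnorm_topology v X) (wnorm_topology w Y) T \<longleftrightarrow>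
      T ` X \<subseteq> Y \<and> (\<forall>a\<in>X. \<forall>\<epsilon>>0. \<exists>\<delta>>0. \<forall>x. x \<in> X \<and> wdist v X a x < \<delta> \<longrightarrow> wdist w Y (T a) (T x) < \<epsilon>)"
    unfolding wnorm_topology_def by (rule MX.metric_continuous_map[OF MY])
  have bounded: "\<exists>C. \<forall>f\<in>X. wnorm w (T f) \<le> C * wnorm v f"
    if im: "T ` X \<subseteq> Y"
      and cont: "\<forall>a\<in>X. \<forall>\<epsilon>>0. \<exists>\<delta>>0. \<forall>x. x \<in> X \<and> wdist v X a x < \<delta> \<longrightarrow> wdist w Y (T a) (T x) < \<epsilon>"
  proof (cases "X = {}")
    case False
    then have zX: "(\<lambda>z. 0) \<in> X"
      using X_scale[of _ 0] by auto
    then have zY: "(\<lambda>z. 0) \<in> Y"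
      using T_scale[OF zX, of 0] im by auto
    have T0: "T (\<lambda>z. 0) = (\<lambda>z. 0)"
      using T_scale[OF zX, of 0] by simp
    obtain \<delta> where \<delta>: "\<delta> > 0"
        "\<And>x. x \<in> X \<Longrightarrow> wdist v X (\<lambda>z. 0) x < \<delta> \<Longrightarrow> wdist w Y (\<lambda>z. 0) (T x) < 1"
      using cont zX T0 by (metis zero_less_one)
    have dX: "wdist v X (\<lambda>z. 0) x = wnorm v x" if "x \<in> X" for x
      using that zX by (simp add: wdist_def wnorm_def)
    have dY: "wdist w Y (\<lambda>z. 0) y = wnorm w y" if "y \<in> Y" for y
      using that zY by (simp add: wdist_def wnorm_def)
    have "wnorm w (T f) \<le> 2 / \<delta> * wnorm v f" if f: "f \<in> X" for f
    proof -
      have fH: "f \<in> H_inf v" and TfY: "T f \<in> Y" and TfH: "T f \<in> H_inf w"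
        using f X im Y by auto
      \<comment> \<open>stated for all admissible scalings, as there is no optimal one when \<open>wnorm v f = 0\<close>\<close>
      have small: "wnorm w (T f) \<le> 1 / c" if c: "c > 0" "c * wnorm v f < \<delta>" for c
      proof (rule wnorm_least)
        fix z
        let ?h = "\<lambda>z. complex_of_real c * f z"
        have h: "?h \<in> X" by (rule X_scale[OF f])
        have "wnorm v ?h < \<delta>"
          using wnorm_scale[OF v fH, of "of_real c"] c by simp
        then have "wnorm w (T ?h) < 1"
          using \<delta>(2)[OF h] dX[OF h] dY[of "T ?h"] h im by auto
        moreover have "w (cmod z) * cmod (T ?h z) \<le> wnorm w (T ?h)"
          using h im Y by (intro wnorm_upper) auto
        ultimately have "w (cmod z) * cmod (T ?h z) \<le> 1"
          by linarith
        then show "w (cmod z) * cmod (T f z) \<le> 1 / c"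
          using c(1) T_scale[OF f, of "of_real c"] by (simp add: norm_mult field_simps)
      qed
      show ?thesis
      proof (cases "wnorm v f = 0")
        case True
        have "wnorm w (T f) \<le> 0"
        proof (rule field_le_epsilon)
          fix e :: real assume "e > 0"
          then show "wnorm w (T f) \<le> 0 + e"
            using small[of "1 / e"] True \<delta>(1) by simp
        qed
        then show ?thesis using True by simp
      next
        case False
        then have "wnorm v f > 0" using wnorm_nonneg[OF v fH] by simp
        then show ?thesis
          using small[of "\<delta> / (2 * wnorm v f)"] \<delta>(1) by (simp add: field_simps)
      qed
    qed
    then show ?thesis by blast
  qed auto
  have cont: "\<forall>a\<in>X. \<forall>\<epsilon>>0. \<exists>\<delta>>0. \<forall>x. x \<in> X \<and> wdist v X a x < \<delta> \<longrightarrow> wdist w Y (T a) (T x) < \<epsilon>"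
    if im: "T ` X \<subseteq> Y" and C: "\<forall>f\<in>X. wnorm w (T f) \<le> C * wnorm v f" for C
  proof (intro ballI allI impI)
    fix a and \<epsilon> :: real assume a: "a \<in> X" and \<epsilon>: "\<epsilon> > 0"
    let ?K = "\<bar>C\<bar> + 1"
    have "wdist w Y (T a) (T x) < \<epsilon>" if x: "x \<in> X" "wdist v X a x < \<epsilon> / ?K" for x
    proof -
      have "wdist w Y (T a) (T x) = wnorm w (T (\<lambda>z. a z - x z))"
        using a x im T_diff[OF a x(1)] by (auto simp: wdist_def)
      also have "\<dots> \<le> C * wnorm v (\<lambda>z. a z - x z)"
        using C X_diff[OF a x(1)] by blast
      also have "\<dots> = C * wdist v X a x" using a x by (simp add: wdist_def)
      also have "\<dots> \<le> ?K * wdist v X a x"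
        by (rule mult_right_mono) (auto simp: MX.nonneg)
      also have "\<dots> < \<epsilon>" using x(2) by (simp add: field_simps)
      finally show ?thesis .
    qed
    moreover have "\<epsilon> / ?K > 0" using \<epsilon> by simp
    ultimately show "\<exists>\<delta>>0. \<forall>x. x \<in> X \<and> wdist v X a x < \<delta> \<longrightarrow> wdist w Y (T a) (T x) < \<epsilon>"
      by blast
  qed
  show ?thesis
    unfolding iff using bounded cont by blast
qed

section \<open>Dilations and polynomial approximation\<close>

lemma power_in_H_zero:
  assumes "is_weight v"
  shows "(\<lambda>z. z ^ n) \<in> H_zero v"
proof -
  have "((\<lambda>r. r ^ n * v r) \<longlongrightarrow> 0) at_top"
    using assms by (simp add: is_weight_def)
  from filterlim_compose[OF this filterlim_norm_at_top, where 'a1 = complex]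
  have "((\<lambda>z. v (cmod z) * cmod (z ^ n)) \<longlongrightarrow> 0) at_infinity"
    by (simp add: norm_power mult.commute)
  then show ?thesis by (auto simp: H_zero_def intro!: holomorphic_intros)
qed

lemma polynomial_in_H_zero:
  assumes v: "is_weight v"
  shows "(\<lambda>z. \<Sum>n<k. c n * z ^ n) \<in> H_zero v"
proof (induction k)
  case 0
  then show ?case by (simp add: H_zero_def)
next
  case (Suc k)
  from H_zero_add[OF v this H_zero_scale[OF power_in_H_zero[OF v]], of "c k" k]
  show ?case by simp
qed

text \<open>Cauchy's inequality on the circle through \<open>z\<close>: each single term of the Taylor series satisfies the
same weighted bound as the function itself.\<close>

lemma taylor_coefficient_bound:
  assumes v: "is_weight v" and hol: "f holomorphic_on UNIV"
    and N: "\<And>z. v (cmod z) * cmod (f z) \<le> N"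
  shows "v (cmod z) * cmod ((deriv ^^ n) f 0 / fact n * z ^ n) \<le> N"
proof (cases "z = 0")
  case True
  have "0 \<le> v (cmod 0) * cmod (f 0)" using weight_pos[OF v, of 0] by simp
  also have "\<dots> \<le> N" by (rule N)
  finally show ?thesis using N[of 0] True by (cases n) auto
next
  case False
  let ?s = "cmod z"
  have s: "?s > 0" using False by simp
  have "cmod (f x) \<le> N / v ?s" if "cmod (0 - x) = ?s" for x
    using N[of x] that weight_pos[OF v, of z] by (simp add: field_simps)
  then have "cmod ((deriv ^^ n) f 0) \<le> fact n * (N / v ?s) / ?s ^ n"
    using hol s by (intro Cauchy_inequality)
      (auto intro: holomorphic_on_subset holomorphic_on_imp_continuous_on)
  then have "cmod ((deriv ^^ n) f 0) * (v ?s * ?s ^ n) \<le> fact n * N"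
    using s weight_pos[OF v, of z] by (simp add: field_simps)
  then show ?thesis
    by (simp add: norm_mult norm_divide norm_power field_simps)
qed

text \<open>The dilation puts a factor \<open>r ^ n\<close> on the \<open>n\<close>-th Taylor term of \<open>f\<close>, whose weighted norm is at most
that of \<open>f\<close>. So the Taylor series of a dilation is dominated in the weighted norm by a geometric
series, and its partial sums converge to the dilation.\<close>

lemma dilation_polynomial_approx:
  assumes v: "is_weight v" and f: "f \<in> H_inf v" and r: "0 \<le> r" "r < 1" and \<epsilon>: "\<epsilon> > 0"
  shows "\<exists>p\<in>H_zero v. (\<exists>k c. p = (\<lambda>z. \<Sum>n<k. c n * z ^ n)) \<and>
     (\<forall>z. v (cmod z) * cmod (f (of_real r * z) - p z) \<le> \<epsilon>)"
proof -
  define N where "N = wnorm v f"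
  have hol: "f holomorphic_on UNIV" using f by (simp add: H_inf_def)
  have N: "v (cmod z) * cmod (f z) \<le> N" for z
    unfolding N_def by (rule wnorm_upper[OF f])
  define a where "a n = (deriv ^^ n) f 0 / fact n" for n
  have a: "v (cmod z) * cmod (a n * z ^ n) \<le> N" for n z
    unfolding a_def by (rule taylor_coefficient_bound[OF v hol N])
  have "(\<lambda>k. N * r ^ k / (1 - r)) \<longlonglongrightarrow> N * 0 / (1 - r)"
    using r by (intro tendsto_intros LIMSEQ_realpow_zero) auto
  then have "eventually (\<lambda>k. N * r ^ k / (1 - r) < \<epsilon>) sequentially"
    using \<epsilon> by (auto dest: order_tendstoD(2))
  then obtain k where k: "N * r ^ k / (1 - r) < \<epsilon>"
    by (auto simp: eventually_sequentially)
  let ?p = "\<lambda>z. \<Sum>n<k. (a n * of_real r ^ n) * z ^ n"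
  have "v (cmod z) * cmod (f (of_real r * z) - ?p z) \<le> \<epsilon>" for z
  proof -
    let ?t = "\<lambda>n. a n * (of_real r * z) ^ n"
    have "of_real r * z \<in> ball 0 (cmod (of_real r * z) + 1)" by simp
    then have "(\<lambda>n. (deriv ^^ n) f 0 / fact n * (of_real r * z - 0) ^ n) sums f (of_real r * z)"
      by (rule holomorphic_power_series[rotated]) (rule holomorphic_on_subset[OF hol], simp)
    then have sums: "?t sums f (of_real r * z)" by (simp add: a_def)
    have tail: "(\<lambda>n. of_real (v (cmod z)) * ?t (n + k)) sums
        (of_real (v (cmod z)) * (f (of_real r * z) - (\<Sum>n<k. ?t n)))"
      by (intro sums_mult sums_split_initial_segment sums)
    have geo: "(\<lambda>n. N * r ^ k * r ^ n) sums (N * r ^ k * (1 / (1 - r)))"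
      using r by (intro sums_mult geometric_sums) auto
    have le: "cmod (of_real (v (cmod z)) * ?t (n + k)) \<le> N * r ^ k * r ^ n" for n
    proof -
      have "cmod (of_real (v (cmod z)) * ?t (n + k)) = (v (cmod z) * cmod (a (n + k) * z ^ (n + k))) * r ^ (n + k)"
        using weight_pos[OF v, of z] r by (simp add: norm_mult norm_power power_mult_distrib)
      also have "\<dots> \<le> N * r ^ (n + k)" using r by (intro mult_right_mono a) auto
      finally show ?thesis by (simp add: power_add mult_ac)
    qed
    have "v (cmod z) * cmod (f (of_real r * z) - (\<Sum>n<k. ?t n))
        = cmod (\<Sum>n. of_real (v (cmod z)) * ?t (n + k))"
      unfolding sums_unique[OF tail, symmetric] using weight_pos[OF v, of z] by (simp only: norm_mult norm_of_real)
    also have "\<dots> \<le> (\<Sum>n. N * r ^ k * r ^ n)"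
      by (rule norm_suminf_le[OF le]) (use geo in \<open>auto simp: sums_iff\<close>)
    also have "\<dots> = N * r ^ k / (1 - r)" using geo by (simp add: sums_iff)
    also have "\<dots> \<le> \<epsilon>" using k by simp
    finally show ?thesis by (simp add: power_mult_distrib mult_ac)
  qed
  moreover have "?p \<in> H_zero v" by (rule polynomial_in_H_zero[OF v])
  ultimately show ?thesis by (intro bexI[of _ ?p] conjI exI[of _ k] exI[of _ "\<lambda>n. a n * of_real r ^ n"]) auto
qed

lemma cmod_dilation_le:
  assumes hol: "f holomorphic_on UNIV" and r: "0 \<le> r" "r \<le> 1"
    and B: "\<And>x. cmod x = cmod z \<Longrightarrow> cmod (f x) \<le> B"
  shows "cmod (f (of_real r * z)) \<le> B"
proof (cases "z = 0")
  case True
  then show ?thesis using B[of 0] by simp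
next
  case False
  show ?thesis
  proof (rule maximum_modulus_frontier[of f "cball 0 (cmod z)"])
    show "f holomorphic_on interior (cball 0 (cmod z))" "continuous_on (closure (cball 0 (cmod z))) f"
      by (auto intro!: holomorphic_on_imp_continuous_on holomorphic_on_subset[OF hol])
    show "of_real r * z \<in> cball 0 (cmod z)"
      using r mult_right_mono[of r 1 "cmod z"] by (simp add: norm_mult)
    show "cmod (f x) \<le> B" if "x \<in> frontier (cball 0 (cmod z))" for x
      using that by (intro B) simp
  qed simp
qed

text \<open>A weight depends on \<open>cmod z\<close> only, so by the maximum principle a dilation by a factor at most \<open>1\<close>
does not increase the weighted norm.\<close>

lemma dilation_bound:
  assumes v: "is_weight v" and f: "f \<in> H_inf v" and r: "0 \<le> r" "r \<le> 1"
  shows "v (cmod z) * cmod (f (of_real r * z)) \<le> wnorm v f"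
proof -
  have B: "cmod (f x) \<le> wnorm v f / v (cmod z)" if "cmod x = cmod z" for x
    using wnorm_upper[OF f, of x] that weight_pos[OF v, of z] by (simp add: field_simps)
  have "cmod (f (of_real r * z)) \<le> wnorm v f / v (cmod z)"
    by (rule cmod_dilation_le[OF _ r B]) (use f in \<open>simp add: H_inf_def\<close>)
  then show ?thesis using weight_pos[OF v, of z] by (simp add: pos_le_divide_eq mult.commute)
qed

lemma weighted_tendsto_0_of_approx:
  assumes v: "\<And>z. 0 \<le> v z"
    and approx: "\<And>\<epsilon>. \<epsilon> > 0 \<Longrightarrow> \<exists>p. ((\<lambda>z. v z * cmod (p z)) \<longlongrightarrow> 0) at_infinity \<and> (\<forall>z. v z * cmod (f z - p z) \<le> \<epsilon>)"
  shows "((\<lambda>z::complex. v z * cmod (f z)) \<longlongrightarrow> 0) at_infinity"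
proof (rule tendstoI)
  fix \<epsilon> :: real assume "\<epsilon> > 0"
  then obtain p where p: "((\<lambda>z. v z * cmod (p z)) \<longlongrightarrow> 0) at_infinity"
      "\<And>z. v z * cmod (f z - p z) \<le> \<epsilon> / 2"
    using approx[of "\<epsilon> / 2"] by auto
  have "eventually (\<lambda>z. v z * cmod (p z) < \<epsilon> / 2) at_infinity"
    using order_tendstoD(2)[OF p(1), of "\<epsilon> / 2"] \<open>\<epsilon> > 0\<close> by simp
  then show "eventually (\<lambda>z. dist (v z * cmod (f z)) 0 < \<epsilon>) at_infinity"
  proof eventually_elim
    case (elim z)
    have "v z * cmod (f z) \<le> v z * (cmod (p z) + cmod (f z - p z))"
      by (intro mult_left_mono v norm_triangle_sub)
    also have "\<dots> < \<epsilon>" using elim p(2)[of z] by (simp add: distrib_left)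
    finally show ?case using v[of z] by (simp add: abs_mult)
  qed
qed

text \<open>Dilations regularize: they take the larger space into the smaller one, because the approximating
polynomials are in the smaller one, which is closed.\<close>

lemma dilation_in_H_zero:
  assumes v: "is_weight v" and f: "f \<in> H_inf v" and r: "0 \<le> r" "r < 1"
  shows "(\<lambda>z. f (of_real r * z)) \<in> H_zero v"
proof -
  have "((\<lambda>z. v (cmod z) * cmod (f (of_real r * z))) \<longlongrightarrow> 0) at_infinity"
  proof (rule weighted_tendsto_0_of_approx)
    show "0 \<le> v (cmod z)" for z using weight_pos[OF v, of z] by simp
    show "\<exists>p. ((\<lambda>z. v (cmod z) * cmod (p z)) \<longlongrightarrow> 0) at_infinity \<and>
        (\<forall>z. v (cmod z) * cmod (f (of_real r * z) - p z) \<le> \<epsilon>)" if "\<epsilon> > 0" for \<epsilon>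
      using dilation_polynomial_approx[OF v f r that] by (auto simp: H_zero_def)
  qed
  moreover have "(f \<circ> (\<lambda>z. of_real r * z)) holomorphic_on UNIV"
    using f by (intro holomorphic_on_compose) (auto simp: H_inf_def intro!: holomorphic_intros intro: holomorphic_on_subset)
  ultimately show ?thesis by (simp add: H_zero_def o_def)
qed

text \<open>Far out both \<open>f\<close> and its dilation are small against the weight, the dilation by the maximum principle;
on the remaining disc \<open>f\<close> is uniformly continuous.\<close>

lemma dilation_tendsto:
  assumes v: "is_weight v" and f: "f \<in> H_zero v" and \<epsilon>: "\<epsilon> > 0"
  shows "\<exists>r. 0 \<le> r \<and> r < 1 \<and> (\<forall>z. v (cmod z) * cmod (f z - f (of_real r * z)) \<le> \<epsilon>)"
proof -
  have hol: "f holomorphic_on UNIV" and lim: "((\<lambda>z. v (cmod z) * cmod (f z)) \<longlongrightarrow> 0) at_infinity"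
    using f by (auto simp: H_zero_def)
  have "eventually (\<lambda>z. v (cmod z) * cmod (f z) < \<epsilon> / 2) at_infinity"
    using order_tendstoD(2)[OF lim, of "\<epsilon> / 2"] \<epsilon> by simp
  then obtain R0 where R0: "\<And>z. cmod z \<ge> R0 \<Longrightarrow> v (cmod z) * cmod (f z) < \<epsilon> / 2"
    by (auto simp: eventually_at_infinity)
  define R where "R = max R0 1"
  have R: "R > 0" "\<And>z. cmod z \<ge> R \<Longrightarrow> v (cmod z) * cmod (f z) < \<epsilon> / 2"
    using R0 by (auto simp: R_def)
  have v0: "v 0 > 0" using v by (simp add: is_weight_def)
  have "uniformly_continuous_on (cball 0 R) f"
    by (intro compact_uniformly_continuous) (auto intro!: holomorphic_on_imp_continuous_on holomorphic_on_subset[OF hol])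
  moreover have "\<epsilon> / v 0 > 0" using \<epsilon> v0 by simp
  ultimately obtain \<delta> where \<delta>: "\<delta> > 0"
    "\<And>x y. x \<in> cball 0 R \<Longrightarrow> y \<in> cball 0 R \<Longrightarrow> dist x y < \<delta> \<Longrightarrow> dist (f x) (f y) < \<epsilon> / v 0"
    unfolding uniformly_continuous_on_def by (metis dist_commute)
  define r where "r = max 0 (1 - \<delta> / (2 * R))"
  have r: "0 \<le> r" "r < 1" using \<delta>(1) R(1) by (auto simp: r_def)
  have "v (cmod z) * cmod (f z - f (of_real r * z)) \<le> \<epsilon>" for z
  proof (cases "cmod z \<le> R")
    case True
    have le: "cmod (of_real r * z) \<le> cmod z"
      using r mult_right_mono[of r 1 "cmod z"] by (simp add: norm_mult)
    have "z - of_real r * z = of_real (1 - r) * z" by (simp add: algebra_simps)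
    then have "dist z (of_real r * z) = (1 - r) * cmod z"
      using r by (simp only: dist_norm norm_mult norm_of_real)
    also have "\<dots> \<le> \<delta> / (2 * R) * R"
      using True r R(1) \<delta>(1) by (intro mult_mono) (auto simp: r_def)
    also have "\<dots> < \<delta>" using R(1) \<delta>(1) by simp
    finally have "dist (f z) (f (of_real r * z)) < \<epsilon> / v 0"
      using True le by (intro \<delta>(2)) auto
    then have "v 0 * cmod (f z - f (of_real r * z)) \<le> \<epsilon>"
      using v0 by (simp add: dist_norm field_simps)
    moreover have "v (cmod z) \<le> v 0"
      using v by (auto simp: is_weight_def monotone_on_def)
    ultimately show ?thesis
      by (meson mult_right_mono norm_ge_zero order_trans)
  next
    case False
    let ?B = "\<epsilon> / 2 / v (cmod z)"
    have B: "cmod (f x) \<le> ?B" if "cmod x = cmod z" for x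
      using R(2)[of x] that False weight_pos[OF v, of z] by (simp add: field_simps)
    have "cmod (f (of_real r * z)) \<le> ?B"
      by (rule cmod_dilation_le[OF hol _ _ B]) (use r in auto)
    with B[of z] have "cmod (f z - f (of_real r * z)) \<le> \<epsilon> / v (cmod z)"
      using norm_triangle_ineq4[of "f z" "f (of_real r * z)"] by (simp add: field_simps)
    then show ?thesis using weight_pos[OF v, of z] by (simp add: field_simps)
  qed
  then show ?thesis using r by blast
qed

section \<open>The associated weight\<close>

lemma assoc_weight_bdd:
  assumes v: "is_weight v"
  shows "bdd_above ((\<lambda>f. cmod (f z)) ` {f \<in> H_inf v. wnorm v f \<le> 1})"
proof (rule bdd_aboveI2)
  fix f assume "f \<in> {f \<in> H_inf v. wnorm v f \<le> 1}"
  then have "v (cmod z) * cmod (f z) \<le> 1"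
    using wnorm_upper[of f v z] by auto
  then show "cmod (f z) \<le> 1 / v (cmod z)"
    using weight_pos[OF v, of z] by (simp add: field_simps)
qed

lemma assoc_weight_pos:
  assumes v: "is_weight v"
  shows "0 < assoc_weight v z"
proof -
  have v0: "v 0 > 0" using v by (simp add: is_weight_def)
  let ?f = "\<lambda>z::complex. complex_of_real (1 / v 0)"
  have le: "v (cmod z) * cmod (?f z) \<le> 1" for z
    using v v0 by (auto simp: is_weight_def monotone_on_def norm_divide)
  have f: "?f \<in> H_inf v" by (rule H_infI[of ?f v 1]) (use le in auto)
  have "wnorm v ?f \<le> 1" by (rule wnorm_least) (use le in auto)
  with f have "?f \<in> {f \<in> H_inf v. wnorm v f \<le> 1}" by blast
  from cSUP_upper[OF this assoc_weight_bdd[OF v], of z]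
  have "cmod (?f z) \<le> (SUP f\<in>{f \<in> H_inf v. wnorm v f \<le> 1}. cmod (f z))" .
  moreover have "cmod (?f z) > 0" using v0 by (simp add: norm_divide)
  ultimately have "0 < (SUP f\<in>{f \<in> H_inf v. wnorm v f \<le> 1}. cmod (f z))"
    by linarith
  then show ?thesis by (simp add: assoc_weight_def)
qed

lemma assoc_weight_le_wnorm:
  assumes v: "is_weight v" and f: "f \<in> H_inf v"
  shows "assoc_weight v z * cmod (f z) \<le> wnorm v f"
proof (rule field_le_epsilon)
  fix e :: real assume "e > 0"
  define N where "N = wnorm v f + e"
  have "N > 0" using wnorm_nonneg[OF v f] \<open>e > 0\<close> by (simp add: N_def)
  let ?h = "\<lambda>z. of_real (1 / N) * f z"
  have "wnorm v ?h \<le> cmod (of_real (1 / N)) * wnorm v f"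
    by (rule wnorm_scale[OF v f])
  also have "\<dots> \<le> 1"
    using \<open>N > 0\<close> \<open>e > 0\<close> by (simp only: norm_of_real) (simp add: N_def)
  finally have "?h \<in> {f \<in> H_inf v. wnorm v f \<le> 1}"
    using H_inf_scale[OF v f] by blast
  from cSUP_upper[OF this assoc_weight_bdd[OF v], of z]
  have "cmod (?h z) \<le> inverse (assoc_weight v z)"
    by (simp add: assoc_weight_def)
  then show "assoc_weight v z * cmod (f z) \<le> wnorm v f + e"
    using assoc_weight_pos[OF v, of z] \<open>N > 0\<close>
    by (simp add: N_def[symmetric] norm_mult norm_divide divide_simps mult.commute)
qed

text \<open>The unit ball of the smaller space suffices to compute the associated weight: a function in the
unit ball of the larger space is the pointwise limit of its dilations, which are in the unit ball
of the smaller one. This is why the condition on the smaller space is as strong as the one on the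
larger space.\<close>

lemma inverse_assoc_weight_le:
  assumes v: "is_weight v"
    and B: "\<And>f. f \<in> H_zero v \<Longrightarrow> wnorm v f \<le> 1 \<Longrightarrow> cmod (f z) \<le> B"
  shows "inverse (assoc_weight v z) \<le> B"
proof -
  have "cmod (f z) \<le> B" if f: "f \<in> H_inf v" "wnorm v f \<le> 1" for f
  proof -
    define r where "r n = 1 - 1 / real (Suc n)" for n
    have r: "0 \<le> r n" "r n < 1" for n by (auto simp: r_def)
    have "r \<longlonglongrightarrow> 1 - 0"
      unfolding r_def by (intro tendsto_diff tendsto_const LIMSEQ_Suc lim_1_over_n)
    then have "(\<lambda>n. complex_of_real (r n) * z) \<longlonglongrightarrow> of_real 1 * z"
      by (intro tendsto_intros) auto
    moreover have "isCont f z"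
      using f by (auto simp: H_inf_def dest!: holomorphic_on_imp_continuous_on simp: continuous_on_eq_continuous_at)
    ultimately have "(\<lambda>n. cmod (f (of_real (r n) * z))) \<longlonglongrightarrow> cmod (f z)"
      by (intro tendsto_norm isCont_tendsto_compose[of z f]) auto
    moreover have "cmod (f (of_real (r n) * z)) \<le> B" for n
    proof (rule B[of "\<lambda>z. f (of_real (r n) * z)"])
      show "(\<lambda>z. f (of_real (r n) * z)) \<in> H_zero v"
        by (rule dilation_in_H_zero[OF v f(1) r])
      show "wnorm v (\<lambda>z. f (of_real (r n) * z)) \<le> 1"
        using dilation_bound[OF v f(1), of "r n"] r[of n] f(2)
        by (intro wnorm_least) (meson less_imp_le order_trans)
    qed
    ultimately show ?thesis by (intro LIMSEQ_le_const2) auto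
  qed
  moreover have "{f \<in> H_inf v. wnorm v f \<le> 1} \<noteq> {}"
  proof -
    have "(\<lambda>z. 0) \<in> H_inf v" by (rule H_infI[of _ _ 0]) auto
    moreover have "wnorm v (\<lambda>z. 0) \<le> 1" by (rule wnorm_least) simp
    ultimately show ?thesis by blast
  qed
  ultimately show ?thesis
    unfolding assoc_weight_def inverse_inverse_eq by (intro cSUP_least) auto
qed

lemma assoc_weight_power_tendsto_0:
  assumes v: "is_weight v"
  shows "((\<lambda>z. assoc_weight v z * cmod (z ^ n)) \<longlongrightarrow> 0) at_infinity"
proof -
  let ?p = "\<lambda>z::complex. z ^ Suc n"
  have p: "?p \<in> H_inf v"
    using H_zero_subset_H_inf[OF v] power_in_H_zero[OF v] by blast
  define N where "N = wnorm v ?p"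
  have "N \<ge> 0" using wnorm_nonneg[OF v p] by (simp add: N_def)
  have le: "assoc_weight v z * cmod (?p z) \<le> N" for z
    unfolding N_def by (rule assoc_weight_le_wnorm[OF v p])
  have lim: "((\<lambda>z::complex. N * inverse (cmod z)) \<longlongrightarrow> 0) at_infinity"
    using tendsto_mult_left[OF filterlim_compose[OF tendsto_inverse_0_at_top[OF filterlim_ident] filterlim_norm_at_top], of N]
    by simp
  have "eventually (\<lambda>z. norm (assoc_weight v z * cmod (z ^ n)) \<le> norm (N * inverse (cmod z)) * 1) at_infinity"
    using eventually_not_equal_at_infinity[of "0::complex"]
  proof eventually_elim
    case (elim z)
    have "assoc_weight v z * cmod (z ^ n) \<le> N * inverse (cmod z)"
      using le[of z] elim by (simp add: norm_mult norm_power field_simps)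
    then show ?case using assoc_weight_pos[OF v, of z] \<open>N \<ge> 0\<close> by (simp add: abs_mult norm_power)
  qed
  then show ?thesis by (rule tendsto_0_le[OF lim])
qed

lemma assoc_weight_polynomial_tendsto_0:
  assumes v: "is_weight v"
  shows "((\<lambda>z. assoc_weight v z * cmod (\<Sum>n<k. c n * z ^ n)) \<longlongrightarrow> 0) at_infinity"
proof -
  have "((\<lambda>z. \<Sum>n<k. cmod (c n) * (assoc_weight v z * cmod (z ^ n))) \<longlongrightarrow> (\<Sum>n<k. cmod (c n) * 0)) at_infinity"
    by (intro tendsto_sum tendsto_mult_left assoc_weight_power_tendsto_0[OF v])
  then have lim: "((\<lambda>z. \<Sum>n<k. cmod (c n) * (assoc_weight v z * cmod (z ^ n))) \<longlongrightarrow> 0) at_infinity"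
    by simp
  show ?thesis
  proof (rule tendsto_0_le[OF lim, of _ 1], rule always_eventually, rule allI)
    fix z
    have "assoc_weight v z * cmod (\<Sum>n<k. c n * z ^ n) \<le> assoc_weight v z * (\<Sum>n<k. cmod (c n * z ^ n))"
      using assoc_weight_pos[OF v, of z] by (intro mult_left_mono norm_sum) auto
    also have "\<dots> = (\<Sum>n<k. cmod (c n) * (assoc_weight v z * cmod (z ^ n)))"
      by (simp add: sum_distrib_left norm_mult mult_ac)
    finally have "assoc_weight v z * cmod (\<Sum>n<k. c n * z ^ n) \<le> \<dots>" .
    then show "norm (assoc_weight v z * cmod (\<Sum>n<k. c n * z ^ n))
        \<le> norm (\<Sum>n<k. cmod (c n) * (assoc_weight v z * cmod (z ^ n))) * 1"
      using assoc_weight_pos[OF v, of z] by (simp add: abs_mult)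
  qed
qed

text \<open>Little-o against \<open>v\<close> improves to little-o against the associated weight. Both weights give the same
bounds for entire functions, so approximation by polynomials in the norm of \<open>v\<close> is also approximation
with respect to the associated weight; and for polynomials the claim holds since the
associated weight decays faster than every power.\<close>

lemma assoc_weight_H_zero_tendsto_0:
  assumes v: "is_weight v" and f: "f \<in> H_zero v"
  shows "((\<lambda>z. assoc_weight v z * cmod (f z)) \<longlongrightarrow> 0) at_infinity"
proof (rule weighted_tendsto_0_of_approx)
  show "0 \<le> assoc_weight v z" for z using assoc_weight_pos[OF v, of z] by simp
  fix \<epsilon> :: real assume \<epsilon>: "\<epsilon> > 0"
  obtain r where r: "0 \<le> r" "r < 1"
      and fr: "\<And>z. v (cmod z) * cmod (f z - f (of_real r * z)) \<le> \<epsilon> / 2"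
    using dilation_tendsto[OF v f, of "\<epsilon> / 2"] \<epsilon> by auto
  have fH: "f \<in> H_inf v" using f H_zero_subset_H_inf[OF v] by blast
  obtain p k c where p: "p \<in> H_zero v" "p = (\<lambda>z. \<Sum>n<k. c n * z ^ n)"
      and pr: "\<And>z. v (cmod z) * cmod (f (of_real r * z) - p z) \<le> \<epsilon> / 2"
    using dilation_polynomial_approx[OF v fH r, of "\<epsilon> / 2"] \<epsilon> by auto
  have le: "v (cmod z) * cmod (f z - p z) \<le> \<epsilon>" for z
  proof -
    have "v (cmod z) * cmod (f z - p z)
        \<le> v (cmod z) * (cmod (f z - f (of_real r * z)) + cmod (f (of_real r * z) - p z))"
      using weight_pos[OF v, of z] norm_triangle_ineq[of "f z - f (of_real r * z)" "f (of_real r * z) - p z"]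
      by (intro mult_left_mono) auto
    then show ?thesis using fr[of z] pr[of z] by (simp add: distrib_left)
  qed
  have "(\<lambda>z. f z - p z) \<in> H_inf v"
    using fH p(1) H_zero_subset_H_inf[OF v] by (intro H_inf_diff[OF v]) auto
  then have "assoc_weight v z * cmod (f z - p z) \<le> wnorm v (\<lambda>z. f z - p z)" for z
    by (rule assoc_weight_le_wnorm[OF v])
  moreover have "wnorm v (\<lambda>z. f z - p z) \<le> \<epsilon>"
    by (rule wnorm_least) (rule le)
  ultimately have "\<forall>z. assoc_weight v z * cmod (f z - p z) \<le> \<epsilon>"
    using order_trans by blast
  then show "\<exists>p. ((\<lambda>z. assoc_weight v z * cmod (p z)) \<longlongrightarrow> 0) at_infinity \<and>
      (\<forall>z. assoc_weight v z * cmod (f z - p z) \<le> \<epsilon>)"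
    using assoc_weight_polynomial_tendsto_0[OF v, of c k] p(2) by (intro exI[of _ p]) simp
qed

section \<open>Growth of the target weight\<close>

lemma increment_le_increment:
  fixes f h :: "real \<Rightarrow> real"
  assumes "R \<le> a" "a \<le> b"
    and f: "\<And>x. R \<le> x \<Longrightarrow> (f has_real_derivative f' x) (at x within {R..})"
    and h: "\<And>x. R \<le> x \<Longrightarrow> (h has_real_derivative h' x) (at x within {R..})"
    and le: "\<And>x. a \<le> x \<Longrightarrow> x \<le> b \<Longrightarrow> f' x \<le> h' x"
  shows "f b - f a \<le> h b - h a"
proof -
  have d: "((\<lambda>x. h x - f x) has_real_derivative (h' x - f' x)) (at x within {R..})" if "R \<le> x" for x
    using that by (intro DERIV_diff h f)
  have "h a - f a \<le> h b - f b"
  proof (rule DERIV_nonneg_imp_increasing_open[OF \<open>a \<le> b\<close>])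
    show "\<exists>y. ((\<lambda>x. h x - f x) has_real_derivative y) (at x) \<and> 0 \<le> y" if "a < x" "x < b" for x
    proof -
      have "at x within {R..} = at x"
        by (rule at_within_interior) (use that \<open>R \<le> a\<close> in simp)
      then show ?thesis
        using d[of x] le[of x] that \<open>R \<le> a\<close> by (intro exI[of _ "h' x - f' x"]) simp
    qed
    have "continuous_on {R..} (\<lambda>x. h x - f x)"
      by (rule DERIV_continuous_on[OF d]) simp
    then show "continuous_on {a..b} (\<lambda>x. h x - f x)"
      by (rule continuous_on_subset) (use \<open>R \<le> a\<close> in auto)
  qed
  then show ?thesis by simp
qed

locale rapid_growth =
  fixes \<phi> \<phi>' \<phi>'' :: "real \<Rightarrow> real" and R :: real
  assumes cont: "continuous_on {0..} \<phi>"
    and mono: "mono_on {0..} \<phi>"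
    and pos: "\<And>r. r \<ge> 0 \<Longrightarrow> \<phi> r > 0"
    and R_pos: "R > 0"
    and deriv1: "\<And>r. r \<ge> R \<Longrightarrow> (\<phi> has_real_derivative \<phi>' r) (at r within {R..})"
    and deriv2: "\<And>r. r \<ge> R \<Longrightarrow> (\<phi>' has_real_derivative \<phi>'' r) (at r within {R..})"
    and mono_deriv: "mono_on {R..} \<phi>'"
    and deriv_pos: "\<phi>' R > 0"
    and deriv_growth: "\<And>n::nat. (\<lambda>r. r ^ n) \<in> O[at_top](\<phi>')"
    and bdd: "bdd_above ((\<lambda>r. \<phi>'' r * \<phi> r / (\<phi>' r)\<^sup>2) ` {R..})"
begin

lemma mono_D: "0 \<le> r \<Longrightarrow> r \<le> s \<Longrightarrow> \<phi> r \<le> \<phi> s"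
  using mono by (auto simp: monotone_on_def)

lemma \<phi>'_pos: "R \<le> r \<Longrightarrow> 0 < \<phi>' r"
  using mono_deriv deriv_pos by (auto simp: monotone_on_def intro: less_le_trans)

lemma deriv_le_\<phi>:
  assumes "R \<le> r"
  shows "\<phi>' r \<le> \<phi> (r + 1)"
proof -
  have "\<phi>' r * (r + 1) - \<phi>' r * r \<le> \<phi> (r + 1) - \<phi> r"
  proof (rule increment_le_increment[OF assms _ _ deriv1, where f = "\<lambda>x. \<phi>' r * x" and f' = "\<lambda>_. \<phi>' r"])
    show "((\<lambda>x. \<phi>' r * x) has_real_derivative \<phi>' r) (at x within {R..})" for x
      by (auto intro!: derivative_eq_intros)
    show "\<phi>' r \<le> \<phi>' x" if "r \<le> x" for x
      using mono_deriv assms that by (auto simp: monotone_on_def)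
  qed auto
  then show ?thesis
    using pos[of r] R_pos assms by (simp add: algebra_simps)
qed

text \<open>The growth of \<open>\<phi>'\<close> beyond all powers passes to \<open>\<phi>\<close>, since \<open>\<phi>' r \<le> \<phi> (r + 1)\<close>. This makes the target
spaces normed spaces, so that their topologies are the expected ones.\<close>

lemma weight_inverse: "is_weight (\<lambda>r. 1 / \<phi> r)"
  unfolding is_weight_def
proof (intro conjI allI impI)
  have "\<phi> r \<noteq> 0" if "0 \<le> r" for r using pos[OF that] by simp
  then show "continuous_on {0..} (\<lambda>r. 1 / \<phi> r)"
    by (intro continuous_on_divide continuous_on_const cont) simp
  show "antimono_on {0..} (\<lambda>r. 1 / \<phi> r)"
    using pos mono_D by (auto simp: monotone_on_def intro!: divide_left_mono mult_pos_pos)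
  show "1 / \<phi> r > 0" if "0 \<le> r" for r using pos[OF that] by simp
  fix m :: nat
  obtain c where c: "c > 0" "eventually (\<lambda>r. norm (r ^ Suc m) \<le> c * norm (\<phi>' r)) at_top"
    using deriv_growth[of "Suc m"] by (elim landau_o.bigE) auto
  then obtain S where S: "\<And>r. r \<ge> S \<Longrightarrow> norm (r ^ Suc m) \<le> c * norm (\<phi>' r)"
    by (auto simp: eventually_at_top_linorder)
  have lim: "((\<lambda>r. 2 ^ m * c / (r - 1)) \<longlongrightarrow> 0) at_top"
    by real_asymp
  have "eventually (\<lambda>r. norm (r ^ m * (1 / \<phi> r)) \<le> norm (2 ^ m * c / (r - 1)) * 1) at_top"
    using eventually_ge_at_top[of "max (max S R + 1) 2"]
  proof eventually_elim
    case (elim r)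
    then have r: "S \<le> r - 1" "R \<le> r - 1" "2 \<le> r" by auto
    have "(r - 1) ^ Suc m \<le> c * \<phi>' (r - 1)"
      using S[OF r(1)] \<phi>'_pos[OF r(2)] r(3) by simp
    also have "\<dots> \<le> c * \<phi> r"
      using deriv_le_\<phi>[OF r(2)] c(1) by simp
    finally have le: "(r - 1) ^ Suc m \<le> c * \<phi> r" .
    have "r ^ m \<le> (2 * (r - 1)) ^ m"
      using r(3) by (intro power_mono) auto
    then have "r ^ m * (r - 1) \<le> 2 ^ m * (r - 1) ^ m * (r - 1)"
      using r(3) unfolding power_mult_distrib by (intro mult_right_mono) auto
    also have "\<dots> = 2 ^ m * (r - 1) ^ Suc m" by simp
    also have "\<dots> \<le> 2 ^ m * (c * \<phi> r)" using le by (intro mult_left_mono) auto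
    finally have "r ^ m * (1 / \<phi> r) \<le> 2 ^ m * c / (r - 1)"
      using r(3) pos[of r] by (simp add: field_simps)
    then show ?case
      using r(3) pos[of r] c(1) by (simp add: abs_mult)
  qed
  then show "((\<lambda>r. r ^ m * (1 / \<phi> r)) \<longlongrightarrow> 0) at_top"
    by (rule tendsto_0_le[OF lim])
qed

text \<open>This is the use of the bound \<open>M\<close> on \<open>\<phi>'' \<phi> / \<phi>'\<^sup>2\<close>. With \<open>q = \<phi> / \<phi>'\<close> it says that
\<open>q' = 1 - \<phi>'' \<phi> / \<phi>'\<^sup>2 \<ge> - M\<close>, so that \<open>q\<close> loses at most half of its value \<open>q r\<close> on a step of length
\<open>q r / (2 M)\<close>. On such a step the logarithmic derivative \<open>1 / q\<close> of \<open>\<phi>\<close> is at most \<open>2 / q r\<close>, hence \<open>ln \<phi>\<close>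
grows by at most \<open>1 / M \<le> 1\<close>.\<close>

lemma bounded_ratio_on_step:
  obtains M where "M \<ge> 1" "\<And>r. R \<le> r \<Longrightarrow> \<phi> (r + \<phi> r / (2 * M * \<phi>' r)) \<le> exp 1 * \<phi> r"
proof -
  obtain M0 where M0: "\<And>r. R \<le> r \<Longrightarrow> \<phi>'' r * \<phi> r / (\<phi>' r)\<^sup>2 \<le> M0"
    using bdd by (auto simp: bdd_above_def)
  define M where "M = max M0 1"
  have M: "M \<ge> 1" "\<And>r. R \<le> r \<Longrightarrow> \<phi>'' r * \<phi> r / (\<phi>' r)\<^sup>2 \<le> M"
    using M0 by (auto simp: M_def le_max_iff_disj)
  define q where "q r = \<phi> r / \<phi>' r" for r
  have q_pos: "0 < q r" if "R \<le> r" for r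
    using pos[of r] \<phi>'_pos[OF that] R_pos that by (simp add: q_def)
  have q_deriv: "(q has_real_derivative (1 - \<phi>'' r * \<phi> r / (\<phi>' r)\<^sup>2)) (at r within {R..})" if "R \<le> r" for r
    unfolding q_def using \<phi>'_pos[OF that]
    by (auto intro!: derivative_eq_intros deriv1 deriv2 that simp: field_simps power2_eq_square)
  have ln_deriv: "((\<lambda>r. ln (\<phi> r)) has_real_derivative (1 / q r)) (at r within {R..})" if "R \<le> r" for r
    using pos[of r] R_pos that
    by (auto intro!: derivative_eq_intros deriv1 that simp: q_def)
  have "\<phi> (r + \<phi> r / (2 * M * \<phi>' r)) \<le> exp 1 * \<phi> r" if r: "R \<le> r" for r
  proof -
    define \<rho> where "\<rho> = q r / (2 * M)"
    have \<rho>: "0 < \<rho>" using q_pos[OF r] M(1) by (simp add: \<rho>_def)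
    have half: "q r / 2 \<le> q x" if x: "r \<le> x" "x \<le> r + \<rho>" for x
    proof -
      have "(- M) * x - (- M) * r \<le> q x - q r"
      proof (rule increment_le_increment[OF r x(1) _ q_deriv, where f = "\<lambda>x. (- M) * x" and f' = "\<lambda>_. - M"])
        show "((\<lambda>x. (- M) * x) has_real_derivative (- M)) (at y within {R..})" for y
          by (auto intro!: derivative_eq_intros)
        show "- M \<le> 1 - \<phi>'' y * \<phi> y / (\<phi>' y)\<^sup>2" if "r \<le> y" for y
          using M(2)[of y] that r by simp
      qed
      moreover have "M * (x - r) \<le> M * \<rho>" using M(1) x(2) by (intro mult_left_mono) auto
      moreover have "M * \<rho> = q r / 2" using M(1) by (simp add: \<rho>_def)
      ultimately show ?thesis by (simp add: algebra_simps)
    qed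
    have "ln (\<phi> (r + \<rho>)) - ln (\<phi> r) \<le> 2 / q r * (r + \<rho>) - 2 / q r * r"
    proof (rule increment_le_increment[OF r _ ln_deriv, where h = "\<lambda>x. 2 / q r * x" and h' = "\<lambda>_. 2 / q r"])
      show "((\<lambda>x. 2 / q r * x) has_real_derivative (2 / q r)) (at y within {R..})" for y
        using q_pos[OF r] by (auto intro!: derivative_eq_intros)
      show "1 / q y \<le> 2 / q r" if "r \<le> y" "y \<le> r + \<rho>" for y
      proof -
        have "1 / q y \<le> 1 / (q r / 2)"
          using half[OF that] q_pos[OF r] q_pos[of y] that r by (intro divide_left_mono) auto
        then show ?thesis by simp
      qed
    qed (use \<rho> in auto)
    also have "\<dots> = 1 / M"
      using less_imp_neq[OF q_pos[OF r], symmetric] M(1) by (simp add: \<rho>_def distrib_left)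
    also have "\<dots> \<le> 1" using M(1) by simp
    finally have "ln (\<phi> (r + \<rho>)) \<le> ln (exp 1 * \<phi> r)"
      using pos[of r] R_pos r by (simp add: ln_mult)
    moreover have "\<phi> (r + \<rho>) > 0" "exp 1 * \<phi> r > 0"
      using pos[of r] pos[of "r + \<rho>"] R_pos r \<rho> by auto
    ultimately have "\<phi> (r + \<rho>) \<le> exp 1 * \<phi> r"
      by (simp only: ln_le_cancel_iff)
    moreover have "\<rho> = \<phi> r / (2 * M * \<phi>' r)" by (simp add: \<rho>_def q_def)
    ultimately show ?thesis by simp
  qed
  with M(1) show thesis by (rule that)
qed

text \<open>Differentiation takes entire functions that grow like \<open>\<phi>\<close> to functions that grow like \<open>\<phi>'\<close>: apply
Cauchy's inequality on a circle whose radius is a small multiple of \<open>\<phi> / \<phi>'\<close>, on which \<open>\<phi>\<close> is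
comparable with its value at the centre.\<close>

lemma deriv_bound_of_growth:
  obtains L where "L \<ge> 0"
    "\<And>F K z. F holomorphic_on UNIV \<Longrightarrow> 0 \<le> K \<Longrightarrow> (\<And>x. cmod (F x) \<le> K * \<phi> (cmod x)) \<Longrightarrow>
       R \<le> cmod z \<Longrightarrow> cmod (deriv F z) \<le> L * K * \<phi>' (cmod z)"
proof -
  obtain M where M: "M \<ge> 1"
    and step: "\<And>r. R \<le> r \<Longrightarrow> \<phi> (r + \<phi> r / (2 * M * \<phi>' r)) \<le> exp 1 * \<phi> r"
    by (rule bounded_ratio_on_step) blast
  have "cmod (deriv F z) \<le> (2 * exp 1 * M) * K * \<phi>' (cmod z)"
    if F: "F holomorphic_on UNIV" and K: "0 \<le> K" and B: "\<And>x. cmod (F x) \<le> K * \<phi> (cmod x)"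
      and z: "R \<le> cmod z" for F K z
  proof -
    let ?r = "cmod z"
    define \<rho> where "\<rho> = \<phi> ?r / (2 * M * \<phi>' ?r)"
    have p: "\<phi> ?r > 0" "\<phi>' ?r > 0" using pos[of ?r] \<phi>'_pos[OF z] by auto
    then have \<rho>: "\<rho> > 0" using M by (simp add: \<rho>_def)
    have "cmod (F x) \<le> K * (exp 1 * \<phi> ?r)" if "cmod (z - x) = \<rho>" for x
    proof -
      have "cmod x \<le> ?r + \<rho>"
        using that norm_triangle_ineq4[of z "z - x"] by simp
      then have "\<phi> (cmod x) \<le> \<phi> (?r + \<rho>)" by (intro mono_D) auto
      also have "\<dots> \<le> exp 1 * \<phi> ?r" using step[OF z] by (simp add: \<rho>_def)
      finally have "K * \<phi> (cmod x) \<le> K * (exp 1 * \<phi> ?r)" using K by (rule mult_left_mono)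
      with B[of x] show ?thesis by linarith
    qed
    then have "cmod ((deriv ^^ 1) F z) \<le> fact 1 * (K * (exp 1 * \<phi> ?r)) / \<rho> ^ 1"
      using \<rho> by (intro Cauchy_inequality)
        (auto intro!: holomorphic_on_imp_continuous_on holomorphic_on_subset[OF F])
    then have "cmod (deriv F z) \<le> K * (exp 1 * \<phi> ?r) / \<rho>" by simp
    also have "\<dots> = (2 * exp 1 * M) * K * \<phi>' ?r"
      using p M by (simp add: \<rho>_def field_simps)
    finally show ?thesis .
  qed
  moreover have "0 \<le> 2 * exp 1 * M" using M by simp
  ultimately show thesis using that by blast
qed

text \<open>The converse: a bound of the derivative by \<open>\<phi>'\<close> is integrated along the ray from the circle of radius
\<open>S\<close> to \<open>z\<close>.\<close>

lemma growth_of_deriv_bound: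
  assumes F: "\<And>z. (F has_field_derivative F' z) (at z)" and S: "R \<le> S" "S \<le> cmod z"
    and B: "\<And>x. S \<le> cmod x \<Longrightarrow> cmod (F' x) \<le> K * \<phi>' (cmod x)"
  shows "cmod (F z) \<le> cmod (F (of_real (S / cmod z) * z)) + K * (\<phi> (cmod z) - \<phi> S)"
proof (cases "S = cmod z")
  case True
  then show ?thesis using R_pos S by auto
next
  case False
  define u where "u = z / of_real (cmod z)"
  have z0: "z \<noteq> 0" using S R_pos by auto
  have u: "cmod u = 1" "of_real (cmod z) * u = z" "of_real S * u = of_real (S / cmod z) * z"
    using z0 by (auto simp: u_def norm_divide)
  have vd: "((\<lambda>t. F (of_real t * u)) has_vector_derivative u * F' (of_real t * u)) (at t)" for t
  proof -
    have "((\<lambda>t. of_real t * u) has_vector_derivative u) (at t)"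
      by (auto simp: has_vector_derivative_def scaleR_conv_of_real[symmetric] intro!: derivative_eq_intros)
    from field_vector_diff_chain_at[OF this F] show ?thesis by (simp add: o_def)
  qed
  have "cmod (F (of_real (cmod z) * u) - F (of_real S * u)) \<le> K * \<phi> (cmod z) - K * \<phi> S"
  proof (rule differentiable_bound_general[where f' = "\<lambda>t. u * F' (of_real t * u)" and \<phi>' = "\<lambda>t. K * \<phi>' t"])
    show "S < cmod z" using False S by simp
    show "continuous_on {S..cmod z} (\<lambda>t. F (of_real t * u))"
      using vd by (intro continuous_at_imp_continuous_on ballI has_vector_derivative_continuous)
    show "continuous_on {S..cmod z} (\<lambda>t. K * \<phi> t)"
      using R_pos S by (intro continuous_intros continuous_on_subset[OF cont]) auto
    fix t assume t: "S < t" "t < cmod z"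
    show "((\<lambda>t. F (of_real t * u)) has_vector_derivative u * F' (of_real t * u)) (at t)" by (rule vd)
    have "(\<phi> has_real_derivative \<phi>' t) (at t)"
      using deriv1[of t] t S at_within_interior[of t "{R..}"] by simp
    then show "((\<lambda>t. K * \<phi> t) has_vector_derivative K * \<phi>' t) (at t)"
      unfolding has_real_derivative_iff_has_vector_derivative[symmetric] by (rule DERIV_cmult)
    have "cmod (of_real t * u) = t" using t S R_pos u(1) by (simp add: norm_mult)
    then show "cmod (u * F' (of_real t * u)) \<le> K * \<phi>' t"
      using B[of "of_real t * u"] t u(1) by (simp add: norm_mult)
  qed
  then have "cmod (F z - F (of_real (S / cmod z) * z)) \<le> K * (\<phi> (cmod z) - \<phi> S)"
    unfolding u by (simp add: algebra_simps)
  then show ?thesis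
    using norm_triangle_sub[of "F z" "F (of_real (S / cmod z) * z)"] by linarith
qed

end

section \<open>The Volterra operator\<close>

lemma Volterra_has_field_derivative:
  assumes g: "g holomorphic_on UNIV" and f: "f holomorphic_on UNIV"
  shows "(Volterra g f has_field_derivative (f z * deriv g z)) (at z)"
proof -
  have "(\<lambda>z. f z * deriv g z) holomorphic_on UNIV"
    using f g by (intro holomorphic_intros) auto
  then obtain P where P: "\<And>z. (P has_field_derivative (f z * deriv g z)) (at z)"
    using holomorphic_convex_primitive'[of UNIV "\<lambda>z. f z * deriv g z"] by auto
  have "Volterra g f z = P z - P 0" for z
    using contour_integral_primitive[of UNIV P "\<lambda>z. f z * deriv g z" "linepath 0 z"] P
    unfolding Volterra_def by (intro contour_integral_unique) auto
  then have "Volterra g f = (\<lambda>z. P z - P 0)" by auto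
  then show ?thesis using P by (auto intro!: derivative_eq_intros)
qed

lemma Volterra_0: "Volterra g f 0 = 0"
  by (simp add: Volterra_def)

lemma Volterra_holomorphic:
  assumes "g holomorphic_on UNIV" "f holomorphic_on UNIV"
  shows "Volterra g f holomorphic_on UNIV"
  using Volterra_has_field_derivative[OF assms] by (auto simp: holomorphic_on_open)

lemma Volterra_integrable:
  assumes "g holomorphic_on UNIV" "f holomorphic_on UNIV"
  shows "(\<lambda>z. f z * deriv g z) contour_integrable_on linepath 0 z"
  using assms
  by (intro contour_integrable_holomorphic_simple[of _ UNIV] holomorphic_intros) auto

lemma Volterra_diff:
  assumes "g holomorphic_on UNIV" "f holomorphic_on UNIV" "h holomorphic_on UNIV"
  shows "Volterra g (\<lambda>z. f z - h z) = (\<lambda>z. Volterra g f z - Volterra g h z)"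
  using assms
  by (simp add: fun_eq_iff Volterra_def left_diff_distrib contour_integral_diff Volterra_integrable)

lemma Volterra_scale:
  assumes "g holomorphic_on UNIV" "f holomorphic_on UNIV"
  shows "Volterra g (\<lambda>z. c * f z) = (\<lambda>z. c * Volterra g f z)"
  using assms
  by (simp add: fun_eq_iff Volterra_def mult.assoc contour_integral_lmul Volterra_integrable)

lemma continuous_map_Volterra_iff:
  assumes v: "is_weight v" and w: "is_weight w" and g: "g holomorphic_on UNIV"
  shows "continuous_map (wnorm_topology v (H_inf v)) (wnorm_topology w (H_inf w)) (Volterra g) \<longleftrightarrow>
      Volterra g ` H_inf v \<subseteq> H_inf w \<and>
      (\<exists>C. \<forall>f\<in>H_inf v. wnorm w (Volterra g f) \<le> C * wnorm v f)"
    and "continuous_map (wnorm_topology v (H_zero v)) (wnorm_topology w (H_zero w)) (Volterra g) \<longleftrightarrow>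
      Volterra g ` H_zero v \<subseteq> H_zero w \<and>
      (\<exists>C. \<forall>f\<in>H_zero v. wnorm w (Volterra g f) \<le> C * wnorm v f)"
proof -
  have hol: "f holomorphic_on UNIV" if "f \<in> H_inf v \<or> f \<in> H_zero v" for f
    using that by (auto simp: H_inf_def H_zero_def)
  show "continuous_map (wnorm_topology v (H_inf v)) (wnorm_topology w (H_inf w)) (Volterra g) \<longleftrightarrow>
      Volterra g ` H_inf v \<subseteq> H_inf w \<and>
      (\<exists>C. \<forall>f\<in>H_inf v. wnorm w (Volterra g f) \<le> C * wnorm v f)"
    by (rule continuous_map_wnorm_iff_bounded[OF v w])
      (auto intro: H_inf_diff[OF v] H_inf_scale[OF v] Volterra_diff[OF g] Volterra_scale[OF g] hol)
  show "continuous_map (wnorm_topology v (H_zero v)) (wnorm_topology w (H_zero w)) (Volterra g) \<longleftrightarrow>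
      Volterra g ` H_zero v \<subseteq> H_zero w \<and>
      (\<exists>C. \<forall>f\<in>H_zero v. wnorm w (Volterra g f) \<le> C * wnorm v f)"
    by (rule continuous_map_wnorm_iff_bounded[OF v w
          H_zero_subset_H_inf[OF v] H_zero_subset_H_inf[OF w]])
      (auto intro: H_zero_diff[OF v] H_zero_scale Volterra_diff[OF g] Volterra_scale[OF g] hol)
qed

context rapid_growth
begin

text \<open>For \<open>f\<close> in the unit ball of \<open>H_zero v\<close>, the function \<open>Volterra g f\<close> grows at most like \<open>\<phi>\<close>, so its derivative
\<open>f * deriv g\<close> is bounded by a multiple of \<open>\<phi>'\<close>. The supremum over all such \<open>f\<close> replaces \<open>f\<close> by the inverse of
the associated weight. The target is stated as the larger space so that both kinds of
continuity are covered.\<close>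

lemma symbol_bound_of_bounded:
  assumes v: "is_weight v" and g: "g holomorphic_on UNIV"
    and im: "Volterra g ` H_zero v \<subseteq> H_inf (\<lambda>r. 1 / \<phi> r)"
    and C: "\<And>f. f \<in> H_zero v \<Longrightarrow> wnorm (\<lambda>r. 1 / \<phi> r) (Volterra g f) \<le> C * wnorm v f"
  shows "bdd_above ((\<lambda>z. cmod (deriv g z) / (\<phi>' (cmod z) * assoc_weight v z)) ` {z. R \<le> cmod z})"
proof -
  obtain L where L: "L \<ge> 0"
    "\<And>F K z. F holomorphic_on UNIV \<Longrightarrow> 0 \<le> K \<Longrightarrow> (\<And>x. cmod (F x) \<le> K * \<phi> (cmod x)) \<Longrightarrow>
       R \<le> cmod z \<Longrightarrow> cmod (deriv F z) \<le> L * K * \<phi>' (cmod z)"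
    by (rule deriv_bound_of_growth) blast
  have "cmod (deriv g z) / (\<phi>' (cmod z) * assoc_weight v z) \<le> L * \<bar>C\<bar>" if z: "R \<le> cmod z" for z
  proof (cases "deriv g z = 0")
    case True
    then show ?thesis using L(1) by simp
  next
    case False
    have "cmod (f z) \<le> L * \<bar>C\<bar> * \<phi>' (cmod z) / cmod (deriv g z)"
      if f: "f \<in> H_zero v" "wnorm v f \<le> 1" for f
    proof -
      have hol: "f holomorphic_on UNIV" using f by (simp add: H_zero_def)
      have fH: "f \<in> H_inf v" using f H_zero_subset_H_inf[OF v] by blast
      have "C * wnorm v f \<le> \<bar>C\<bar> * 1"
        using f(2) wnorm_nonneg[OF v fH] by (intro mult_mono) auto
      then have norm: "wnorm (\<lambda>r. 1 / \<phi> r) (Volterra g f) \<le> \<bar>C\<bar>"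
        using C[OF f(1)] by simp
      have "cmod (Volterra g f x) \<le> \<bar>C\<bar> * \<phi> (cmod x)" for x
      proof -
        have "1 / \<phi> (cmod x) * cmod (Volterra g f x) \<le> \<bar>C\<bar>"
          using wnorm_upper[of "Volterra g f" "\<lambda>r. 1 / \<phi> r" x] im f(1) norm by auto
        then show ?thesis using pos[of "cmod x"] by (simp add: field_simps)
      qed
      then have "cmod (deriv (Volterra g f) z) \<le> L * \<bar>C\<bar> * \<phi>' (cmod z)"
        by (intro L(2) Volterra_holomorphic g hol z) auto
      then show ?thesis
        using DERIV_imp_deriv[OF Volterra_has_field_derivative[OF g hol, of z]] False
        by (simp add: norm_mult field_simps)
    qed
    then have "inverse (assoc_weight v z) \<le> L * \<bar>C\<bar> * \<phi>' (cmod z) / cmod (deriv g z)"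
      by (rule inverse_assoc_weight_le[OF v])
    then show ?thesis
      using False \<phi>'_pos[OF z] assoc_weight_pos[OF v, of z] by (simp add: field_simps)
  qed
  then show ?thesis by (intro bdd_aboveI2[of _ _ "L * \<bar>C\<bar>"]) simp
qed

text \<open>As \<open>cmod (f z)\<close> is at most \<open>wnorm v f\<close> divided by the associated weight, the condition on \<open>g\<close> bounds the derivative of
\<open>Volterra g f\<close> by \<open>K * wnorm v f * \<phi>'\<close> outside the disc of radius \<open>R\<close>, and integration gives \<open>\<phi>\<close>. The disc
contributes a constant multiple of \<open>wnorm v f\<close>, harmless because \<open>\<phi> \<ge> \<phi> 0 > 0\<close>.\<close>

lemma bounded_of_symbol_bound:
  assumes v: "is_weight v" and g: "g holomorphic_on UNIV" and K: "0 \<le> K"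
    and bound: "\<And>z. R \<le> cmod z \<Longrightarrow> cmod (deriv g z) \<le> K * \<phi>' (cmod z) * assoc_weight v z"
  shows "\<exists>C. \<forall>f\<in>H_inf v. \<forall>z. 1 / \<phi> (cmod z) * cmod (Volterra g f z) \<le> C * wnorm v f"
proof -
  have "continuous_on (cball 0 R) (deriv g)"
    using g by (intro holomorphic_on_imp_continuous_on holomorphic_on_subset[OF holomorphic_deriv[OF g]]) auto
  then have "bounded (deriv g ` cball 0 R)"
    by (intro compact_imp_bounded compact_continuous_image) auto
  then obtain G where G: "G > 0" "\<And>z. cmod z \<le> R \<Longrightarrow> cmod (deriv g z) \<le> G"
    by (auto simp: bounded_pos)
  define A where "A = G / v R * R"
  have vR: "v R > 0" using v R_pos by (simp add: is_weight_def)
  then have A: "A \<ge> 0" using G R_pos by (simp add: A_def)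
  have "1 / \<phi> (cmod z) * cmod (Volterra g f z) \<le> (A / \<phi> 0 + K) * wnorm v f" if f: "f \<in> H_inf v" for f z
  proof -
    define N where "N = wnorm v f"
    have N: "N \<ge> 0" using wnorm_nonneg[OF v f] by (simp add: N_def)
    have hol: "f holomorphic_on UNIV" using f by (simp add: H_inf_def)
    note F = Volterra_has_field_derivative[OF g hol]
    have inner: "cmod (Volterra g f x) \<le> A * N" if x: "cmod x \<le> R" for x
    proof -
      have "cmod (f y * deriv g y) \<le> N / v R * G" if "y \<in> cball 0 R" for y
      proof -
        have "v R * cmod (f y) \<le> v (cmod y) * cmod (f y)"
          using v that R_pos by (intro mult_right_mono) (auto simp: is_weight_def monotone_on_def)
        also have "\<dots> \<le> N" unfolding N_def by (rule wnorm_upper[OF f])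
        finally have "cmod (f y) \<le> N / v R" using vR by (simp add: field_simps)
        then show ?thesis
          using G(2)[of y] that N vR unfolding norm_mult by (intro mult_mono) auto
      qed
      then have "cmod (Volterra g f x - Volterra g f 0) \<le> N / v R * G * cmod (x - 0)"
        using x R_pos by (intro field_differentiable_bound[where S = "cball 0 R" and f' = "\<lambda>z. f z * deriv g z"] has_field_derivative_at_within[OF F]) auto
      also have "\<dots> \<le> N / v R * G * R"
        using x N vR G(1) by (intro mult_left_mono) auto
      finally show ?thesis by (simp add: Volterra_0 A_def mult_ac)
    qed
    have "cmod (Volterra g f z) \<le> A * N + K * N * \<phi> (cmod z)"
    proof (cases "cmod z \<le> R")
      case True
      then show ?thesis using inner[OF True] K N pos[of "cmod z"] by (simp add: add_increasing2)
    next
      case False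
      have "cmod (f x * deriv g x) \<le> K * N * \<phi>' (cmod x)" if x: "R \<le> cmod x" for x
      proof -
        have "cmod (f x * deriv g x) \<le> cmod (f x) * (K * \<phi>' (cmod x) * assoc_weight v x)"
          unfolding norm_mult by (intro mult_left_mono bound x) auto
        also have "\<dots> = K * \<phi>' (cmod x) * (assoc_weight v x * cmod (f x))" by simp
        also have "\<dots> \<le> K * \<phi>' (cmod x) * N"
          unfolding N_def using K \<phi>'_pos[OF x] by (intro mult_left_mono assoc_weight_le_wnorm[OF v f]) auto
        finally show ?thesis by (simp add: mult_ac)
      qed
      from growth_of_deriv_bound[OF F order_refl _ this]
      have "cmod (Volterra g f z) \<le> cmod (Volterra g f (of_real (R / cmod z) * z)) + K * N * (\<phi> (cmod z) - \<phi> R)"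
        using False by simp
      also have "\<dots> \<le> A * N + K * N * \<phi> (cmod z)"
      proof (intro add_mono mult_left_mono inner)
        show "cmod (of_real (R / cmod z) * z) \<le> R" using False R_pos by (auto simp: norm_mult norm_divide)
      qed (use K N pos[of R] R_pos in auto)
      finally show ?thesis .
    qed
    then have "1 / \<phi> (cmod z) * cmod (Volterra g f z) \<le> A * N / \<phi> (cmod z) + K * N"
      using pos[of "cmod z"] by (simp add: field_simps)
    also have "A * N / \<phi> (cmod z) \<le> A * N / \<phi> 0"
      using A N pos[of 0] pos[of "cmod z"] mono_D[of 0 "cmod z"] by (intro divide_left_mono) auto
    finally show ?thesis by (simp add: N_def algebra_simps)
  qed
  then show ?thesis by blast
qed

text \<open>The estimate is the same as for boundedness, but started at a circle outside of which \<open>f\<close> times the associated weight is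
below \<open>\<epsilon>\<close>. It shows that \<open>Volterra g f\<close> is at most \<open>B + K * \<epsilon> * \<phi>\<close>, where the constant \<open>B\<close> is negligible against
\<open>\<phi>\<close>.\<close>

lemma Volterra_H_zero:
  assumes v: "is_weight v" and g: "g holomorphic_on UNIV" and K: "0 \<le> K"
    and bound: "\<And>z. R \<le> cmod z \<Longrightarrow> cmod (deriv g z) \<le> K * \<phi>' (cmod z) * assoc_weight v z"
    and f: "f \<in> H_zero v"
  shows "Volterra g f \<in> H_zero (\<lambda>r. 1 / \<phi> r)"
proof -
  have hol: "f holomorphic_on UNIV" using f by (simp add: H_zero_def)
  note F = Volterra_has_field_derivative[OF g hol]
  have "((\<lambda>r. r ^ 0 * (1 / \<phi> r)) \<longlongrightarrow> 0) at_top"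
    using weight_inverse by (simp only: is_weight_def)
  from filterlim_compose[OF this filterlim_norm_at_top, where 'a1 = complex]
  have inv: "((\<lambda>z::complex. 1 / \<phi> (cmod z)) \<longlongrightarrow> 0) at_infinity" by simp
  have "((\<lambda>z. 1 / \<phi> (cmod z) * cmod (Volterra g f z)) \<longlongrightarrow> 0) at_infinity"
  proof (rule tendstoI)
    fix e :: real assume e: "e > 0"
    \<comment> \<open>half of \<open>e\<close> is for the constant \<open>B\<close>; the summand \<open>1\<close> allows for \<open>K = 0\<close>\<close>
    define \<epsilon> where "\<epsilon> = e / (2 * (K + 1))"
    have \<epsilon>: "\<epsilon> > 0" and K\<epsilon>: "K * \<epsilon> < e / 2" using e K by (auto simp: \<epsilon>_def field_simps)
    have "eventually (\<lambda>z. assoc_weight v z * cmod (f z) < \<epsilon>) at_infinity"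
      using order_tendstoD(2)[OF assoc_weight_H_zero_tendsto_0[OF v f] \<epsilon>] .
    then obtain S0 where S0: "\<And>z. S0 \<le> cmod z \<Longrightarrow> assoc_weight v z * cmod (f z) < \<epsilon>"
      by (auto simp: eventually_at_infinity)
    define S where "S = max S0 R"
    have S: "R \<le> S" "\<And>z. S \<le> cmod z \<Longrightarrow> assoc_weight v z * cmod (f z) \<le> \<epsilon>"
      using S0 by (auto simp: S_def less_imp_le)
    have deriv: "cmod (f x * deriv g x) \<le> K * \<epsilon> * \<phi>' (cmod x)" if x: "S \<le> cmod x" for x
    proof -
      have xR: "R \<le> cmod x" using x S(1) by simp
      have "cmod (f x * deriv g x) \<le> cmod (f x) * (K * \<phi>' (cmod x) * assoc_weight v x)"
        unfolding norm_mult by (intro mult_left_mono bound xR) auto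
      also have "\<dots> = K * \<phi>' (cmod x) * (assoc_weight v x * cmod (f x))" by simp
      also have "\<dots> \<le> K * \<phi>' (cmod x) * \<epsilon>"
        using K \<phi>'_pos[OF xR] by (intro mult_left_mono S(2) x) auto
      finally show ?thesis by (simp add: mult_ac)
    qed
    have "continuous_on (cball 0 S) (Volterra g f)"
      by (intro holomorphic_on_imp_continuous_on holomorphic_on_subset[OF Volterra_holomorphic[OF g hol]]) auto
    then have "bounded (Volterra g f ` cball 0 S)"
      by (intro compact_imp_bounded compact_continuous_image) auto
    then obtain B where B: "\<And>z. cmod z \<le> S \<Longrightarrow> cmod (Volterra g f z) \<le> B"
      by (force simp: bounded_iff)
    have "((\<lambda>z::complex. B * (1 / \<phi> (cmod z))) \<longlongrightarrow> B * 0) at_infinity"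
      by (intro tendsto_mult_left inv)
    then have "eventually (\<lambda>z::complex. B * (1 / \<phi> (cmod z)) < e / 2) at_infinity"
      using e by (intro order_tendstoD(2)) auto
    moreover have "eventually (\<lambda>z::complex. S \<le> cmod z) at_infinity"
      by (auto simp: eventually_at_infinity)
    ultimately show "eventually (\<lambda>z. dist (1 / \<phi> (cmod z) * cmod (Volterra g f z)) 0 < e) at_infinity"
    proof eventually_elim
      case (elim z)
      have "cmod (Volterra g f z) \<le> cmod (Volterra g f (of_real (S / cmod z) * z)) + K * \<epsilon> * (\<phi> (cmod z) - \<phi> S)"
        by (rule growth_of_deriv_bound[OF F S(1) elim(2) deriv])
      also have "\<dots> \<le> B + K * \<epsilon> * \<phi> (cmod z)"
      proof (intro add_mono mult_left_mono B)
        show "cmod (of_real (S / cmod z) * z) \<le> S" using S(1) R_pos by (auto simp: norm_mult norm_divide)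
      qed (use K \<epsilon> pos[of S] S(1) R_pos in auto)
      finally have "1 / \<phi> (cmod z) * cmod (Volterra g f z) \<le> B * (1 / \<phi> (cmod z)) + K * \<epsilon>"
        using pos[of "cmod z"] by (simp add: field_simps)
      also have "\<dots> < e" using elim(1) K\<epsilon> by linarith
      finally show ?case using pos[of "cmod z"] by simp
    qed
  qed
  then show ?thesis using Volterra_holomorphic[OF g hol] by (simp add: H_zero_def)
qed

end

section \<open>Characterization of continuity\<close>

theorem theorem3p4:
  fixes v \<phi> \<phi>' \<phi>'' :: "real \<Rightarrow> real" and r\<^sub>\<phi> :: real and g :: "complex \<Rightarrow> complex"
  assumes "is_weight v"
    and "continuous_on {0..} \<phi>" and "mono_on {0..} \<phi>" and "\<And>r. r \<ge> 0 \<Longrightarrow> \<phi> r > 0"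
    and "r\<^sub>\<phi> > 0"
    and "\<And>r. r \<ge> r\<^sub>\<phi> \<Longrightarrow> (\<phi> has_real_derivative \<phi>' r) (at r within {r\<^sub>\<phi>..})"
    and "\<And>r. r \<ge> r\<^sub>\<phi> \<Longrightarrow> (\<phi>' has_real_derivative \<phi>'' r) (at r within {r\<^sub>\<phi>..})"
    and "continuous_on {r\<^sub>\<phi>..} \<phi>''"
    and "mono_on {r\<^sub>\<phi>..} \<phi>'" and "\<phi>' r\<^sub>\<phi> > 0"
    and "\<And>n::nat. (\<lambda>r. r ^ n) \<in> O[at_top](\<phi>')"
    and "bdd_above ((\<lambda>r. \<phi>'' r * \<phi> r / (\<phi>' r)\<^sup>2) ` {r\<^sub>\<phi>..})"
    and "g holomorphic_on UNIV"
  shows "(continuous_map (wnorm_topology v (H_inf v))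
             (wnorm_topology (\<lambda>r. 1 / \<phi> r) (H_inf (\<lambda>r. 1 / \<phi> r)))
             (Volterra g) \<longleftrightarrow>
          continuous_map (wnorm_topology v (H_zero v))
             (wnorm_topology (\<lambda>r. 1 / \<phi> r) (H_zero (\<lambda>r. 1 / \<phi> r)))
             (Volterra g)) \<and>
         (continuous_map (wnorm_topology v (H_zero v))
             (wnorm_topology (\<lambda>r. 1 / \<phi> r) (H_zero (\<lambda>r. 1 / \<phi> r)))
             (Volterra g) \<longleftrightarrow>
          bdd_above ((\<lambda>z. cmod (deriv g z) / (\<phi>' (cmod z) * assoc_weight v z)) `
             {z. cmod z \<ge> r\<^sub>\<phi>}))"
proof -
  let ?w = "\<lambda>r. 1 / \<phi> r"
  interpret rapid_growth \<phi> \<phi>' \<phi>'' r\<^sub>\<phi>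
    by unfold_locales (use assms in auto)
  note v = \<open>is_weight v\<close> and w = weight_inverse and g = \<open>g holomorphic_on UNIV\<close>
  note iff = continuous_map_Volterra_iff[OF v w g]
  let ?inf = "continuous_map (wnorm_topology v (H_inf v)) (wnorm_topology ?w (H_inf ?w)) (Volterra g)"
  let ?zero = "continuous_map (wnorm_topology v (H_zero v)) (wnorm_topology ?w (H_zero ?w)) (Volterra g)"
  let ?bdd = "bdd_above ((\<lambda>z. cmod (deriv g z) / (\<phi>' (cmod z) * assoc_weight v z)) ` {z. cmod z \<ge> r\<^sub>\<phi>})"
  have "?bdd" if "?inf"
  proof -
    from that[unfolded iff(1)] obtain C where im: "Volterra g ` H_inf v \<subseteq> H_inf ?w"
      and C: "\<And>f. f \<in> H_inf v \<Longrightarrow> wnorm ?w (Volterra g f) \<le> C * wnorm v f" by blast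
    show ?thesis
      using im C H_zero_subset_H_inf[OF v] by (intro symbol_bound_of_bounded[OF v g, of C]) auto
  qed
  moreover have "?bdd" if "?zero"
  proof -
    from that[unfolded iff(2)] obtain C where im: "Volterra g ` H_zero v \<subseteq> H_zero ?w"
      and C: "\<And>f. f \<in> H_zero v \<Longrightarrow> wnorm ?w (Volterra g f) \<le> C * wnorm v f" by blast
    show ?thesis
      using im C H_zero_subset_H_inf[OF w] by (intro symbol_bound_of_bounded[OF v g, of C]) auto
  qed
  moreover have "?inf \<and> ?zero" if bdd: "?bdd"
  proof -
    obtain K0 where K0: "\<And>z. r\<^sub>\<phi> \<le> cmod z \<Longrightarrow> cmod (deriv g z) / (\<phi>' (cmod z) * assoc_weight v z) \<le> K0"
      using bdd by (auto simp: bdd_above_def)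
    define K where "K = max K0 0"
    have K: "0 \<le> K" by (simp add: K_def)
    have bound: "cmod (deriv g z) \<le> K * \<phi>' (cmod z) * assoc_weight v z" if "r\<^sub>\<phi> \<le> cmod z" for z
    proof -
      have "cmod (deriv g z) / (\<phi>' (cmod z) * assoc_weight v z) \<le> K"
        using K0[OF that] by (simp add: K_def)
      then show ?thesis
        using \<phi>'_pos[OF that] assoc_weight_pos[OF v, of z] by (simp add: field_simps)
    qed
    obtain C where C: "\<And>f z. f \<in> H_inf v \<Longrightarrow> ?w (cmod z) * cmod (Volterra g f z) \<le> C * wnorm v f"
      using bounded_of_symbol_bound[OF v g K bound] by blast
    have norm: "wnorm ?w (Volterra g f) \<le> C * wnorm v f" if "f \<in> H_inf v" for f
      by (rule wnorm_least) (rule C[OF that])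
    have "Volterra g f \<in> H_inf ?w" if "f \<in> H_inf v" for f
    proof (rule H_infI)
      show "Volterra g f holomorphic_on UNIV"
        using that by (intro Volterra_holomorphic g) (simp add: H_inf_def)
    qed (rule C[OF that])
    then have "?inf" unfolding iff(1) using norm by blast
    moreover have "?zero"
      unfolding iff(2) using norm H_zero_subset_H_inf[OF v] Volterra_H_zero[OF v g K bound] by blast
    ultimately show ?thesis by blast
  qed
  ultimately show ?thesis by argo
qed

end
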